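(* Let $\mathcal{G}=(\mathcal V,\mathcal E)$ be a simple, connected, undirected graph on $n$ vertices with Laplacian matrix $\mathrm{L}\in\mathbb{R}^{n\times n}$, let $\lambda_n$ be the largest eigenvalue of $\mathrm{L}$, let $d\ge 1$, and set $\mathbf{L}=\mathrm{L}\otimes I_d$. For $i=1,\dots,n$ let $f_i:\mathbb{R}^d\to\mathbb{R}$ be closed, proper, convex and differentiable with $L_i$-Lipschitz gradient, and let $g_i:\mathbb{R}^d\to\mathbb{R}\cup\{\infty\}$ be proper, convex and lower semicontinuous. For $\mathbf{x}=(x_1^\top,\dots,x_n^\top)^\top\in\mathbb{R}^{nd}$ put $f(\mathbf{x})=\sum_{i=1}^n f_i(x_i)$, $g(\mathbf{x})=\sum_{i=1}^n g_i(x_i)$, and let $L_f=\max_i L_i$. Let $\rho\ge 0$ and let $\mathcal{L}(\mathbf{x},\mathbf{y})=f(\mathbf{x})+g(\mathbf{x})+\mathbf{y}^\top\sqrt{\mathbf{L}}\,\mathbf{x}+\frac{\rho}{2}\mathbf{x}^\top\mathbf{L}\mathbf{x}$ for $\mathbf{x},\mathbf{y}\in\mathbb{R}^{nd}$. Let $(\mathbf{x}^\star,\mathbf{y}^\star)$ with $\mathbf{x}^\star\in\mathbb{R}^{nd}$ and $\mathbf{y}^\star\in(\ker\sqrt{\mathbf{L}})^\perp$ be a saddle point of $\mathcal{L}$, i.e. $\mathcal{L}(\mathbf{x}^\star,\mathbf{y})\le\mathcal{L}(\mathbf{x}^\star,\mathbf{y}^\star)\le\mathcal{L}(\mathbf{x},\mathbf{y}^\star)$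 for all $\mathbf{x}\in\mathbb{R}^{nd}$ and all $\mathbf{y}\in(\ker\sqrt{\mathbf{L}})^\perp$. Let $\alpha,\beta>0$ satisfy $$\frac{1}{\beta+\rho}\Big(\frac{1}{\alpha}-L_f\Big)\ge\lambda_n .$$ Let $\mathbf{x}^0\in\ker\sqrt{\mathbf{L}}$ and $\mathbf{y}^0\in(\ker\sqrt{\mathbf{L}})^\perp$, and define, for $k\ge 0$, $$\hat{\mathbf{x}}^{k+1}=\mathbf{x}^k-\alpha\big(\nabla f(\mathbf{x}^k)+\sqrt{\mathbf{L}}\,\mathbf{y}^k+\rho\,\mathbf{L}\mathbf{x}^k\big),$$ $$\mathbf{x}^{k+1}=\operatorname*{argmin}_{\mathbf{x}\in\mathbb{R}^{nd}}\Big\{g(\mathbf{x})+\frac{1}{2\alpha}\|\mathbf{x}-\hat{\mathbf{x}}^{k+1}\|_2^2\Big\},$$ $$\mathbf{y}^{k+1}=\mathbf{y}^k+\beta\sqrt{\mathbf{L}}\,(2\mathbf{x}^{k+1}-\mathbf{x}^k).$$ Then for every $N\ge 1$, with $\bar{\mathbf{x}}^N=\frac1N\sum_{k=1}^N\mathbf{x}^k$ and $\bar{\mathbf{y}}^N=\frac1N\sum_{k=1}^N\mathbf{y}^k$, $$\mathcal{L}(\bar{\mathbf{x}}^N,\mathbf{y}^\star)-\mathcal{L}(\mathbf{x}^\star,\bar{\mathbf{y}}^N)\le\frac1N\left(\frac{\|\mathbf{x}^\star-\mathbf{x}^0\|_2^2}{2\alpha}+\frac{\|\mathbf{y}^\s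tar-\mathbf{y}^0\|_2^2}{2\beta}\right).$$
   Context: The Laplacian of $\mathcal{G}$ is $\mathrm{L}=\operatorname{diag}(A1_n)-A$, where $A$ is the 0/1 adjacency matrix and $1_n$ is the all-ones vector; it is symmetric positive semidefinite. $\otimes$ is the Kronecker product and $I_d$ the $d\times d$ identity. $\sqrt{\mathbf{L}}$ denotes the symmetric positive semidefinite square root of $\mathbf{L}$ (equivalently $\sqrt{\mathrm{L}}\otimes I_d$); its kernel is $\{1_n\otimes x : x\in\mathbb{R}^d\}$. The gradient of $f$ is $\nabla f(\mathbf{x})=(\nabla f_1(x_1)^\top,\dots,\nabla f_n(x_n)^\top)^\top$. A differentiable function $h$ on $\mathbb{R}^d$ has $L$-Lipschitz gradient if $\|\nabla h(x)-\nabla h(y)\|_2\le L\|x-y\|_2$ for all $x,y$. *)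

theory Defs
  imports "HOL-Analysis.Analysis"
begin

text \<open>A graph has the whole (finite) index type as its vertex set; an undirected edge between
  \<open>u\<close> and \<open>v\<close> is represented by the two pairs \<open>(u, v)\<close> and \<open>(v, u)\<close>.\<close>

definition simple_graph :: "('n \<times> 'n) set \<Rightarrow> bool" where
  "simple_graph E \<longleftrightarrow> sym E \<and> irrefl E"

definition connected_graph :: "('n \<times> 'n) set \<Rightarrow> bool" where
  "connected_graph E \<longleftrightarrow> (\<forall>u v. (u, v) \<in> E\<^sup>*)"

definition adjacency_matrix :: "('n::finite \<times> 'n) set \<Rightarrow> real^'n^'n" where
  "adjacency_matrix E = (\<chi> i j. if (i, j) \<in> E then 1 else 0)"

definition diag_matrix :: "real^'n \<Rightarrow> real^'n^'n" where
  "diag_matrix v = (\<chi> i j. if i = j then v $ i else 0)"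

text \<open>The vector \<open>1\<close> below is the all-ones vector.\<close>

definition laplacian :: "('n::finite \<times> 'n) set \<Rightarrow> real^'n^'n" where
  "laplacian E = diag_matrix (adjacency_matrix E *v 1) - adjacency_matrix E"

definition is_eigenvalue :: "real^'n^'n \<Rightarrow> real \<Rightarrow> bool" where
  "is_eigenvalue A c \<longleftrightarrow> (\<exists>v. v \<noteq> 0 \<and> A *v v = c *\<^sub>R v)"

definition largest_eigenvalue :: "real^'n^'n \<Rightarrow> real" where
  "largest_eigenvalue A = Max {c. is_eigenvalue A c}"

definition kronecker_product ::
    "real^'a^'b \<Rightarrow> real^'c^'e \<Rightarrow> real^('a \<times> 'c)^('b \<times> 'e)" (infixl \<open>\<otimes>\<^sub>K\<close> 70) where
  "A \<otimes>\<^sub>K B = (\<chi> p q. A $ fst p $ fst q * B $ snd p $ snd q)"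

definition pos_semidef :: "real^'n^'n \<Rightarrow> bool" where
  "pos_semidef A \<longleftrightarrow> transpose A = A \<and> (\<forall>x. 0 \<le> x \<bullet> (A *v x))"

definition psd_sqrt :: "real^'n^'n \<Rightarrow> real^'n^'n" where
  "psd_sqrt A = (THE S. pos_semidef S \<and> S ** S = A)"

definition mat_kernel :: "real^'n^'m \<Rightarrow> (real^'n) set" where
  "mat_kernel A = {x. A *v x = 0}"

text \<open>The space \<open>\<real>\<^sup>n\<^sup>d\<close> is \<^typ>\<open>real^('n \<times> 'd)\<close>: the coordinate at \<open>(i, j)\<close> is the \<open>j\<close>-th
  coordinate of the \<open>i\<close>-th block.\<close>

definition block :: "'n \<Rightarrow> real^('n::finite \<times> 'd::finite) \<Rightarrow> real^'d" where
  "block i x = (\<chi> j. x $ (i, j))"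

definition stack :: "('n \<Rightarrow> real^'d) \<Rightarrow> real^('n::finite \<times> 'd::finite)" where
  "stack v = (\<chi> p. v (fst p) $ snd p)"

definition epi :: "('a \<Rightarrow> ereal) \<Rightarrow> ('a \<times> real) set" where
  "epi h = {(x, r). h x \<le> ereal r}"

definition proper_fun :: "('a \<Rightarrow> ereal) \<Rightarrow> bool" where
  "proper_fun h \<longleftrightarrow> (\<forall>x. h x \<noteq> -\<infinity>) \<and> (\<exists>x. h x \<noteq> \<infinity>)"

definition closed_fun :: "('a::topological_space \<Rightarrow> ereal) \<Rightarrow> bool" where
  "closed_fun h \<longleftrightarrow> closed (epi h)"

definition convex_fun :: "('a::real_vector \<Rightarrow> ereal) \<Rightarrow> bool" where
  "convex_fun h \<longleftrightarrow> convex (epi h)"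

definition lower_semicontinuous :: "('a::topological_space \<Rightarrow> ereal) \<Rightarrow> bool" where
  "lower_semicontinuous h \<longleftrightarrow> (\<forall>x. h x \<le> Liminf (at x) h)"

definition grad :: "('a::real_inner \<Rightarrow> real) \<Rightarrow> 'a \<Rightarrow> 'a" where
  "grad h x = (THE D. GDERIV h x :> D)"

definition sep_sum ::
    "('n \<Rightarrow> real^'d \<Rightarrow> 'b::comm_monoid_add) \<Rightarrow> real^('n::finite \<times> 'd::finite) \<Rightarrow> 'b" where
  "sep_sum h x = (\<Sum>i\<in>UNIV. h i (block i x))"

definition sep_grad ::
    "('n \<Rightarrow> real^'d \<Rightarrow> real) \<Rightarrow> real^('n::finite \<times> 'd::finite) \<Rightarrow> real^('n \<times> 'd)" where
  "sep_grad f x = stack (\<lambda>i. grad (f i) (block i x))"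

text \<open>The argument \<open>M\<close> stands for \<open>L \<otimes>\<^sub>K mat 1\<close> with \<open>L\<close> the graph Laplacian.\<close>

definition lagrangian ::
    "real^('n \<times> 'd)^('n \<times> 'd) \<Rightarrow> ('n \<Rightarrow> real^'d \<Rightarrow> real) \<Rightarrow> ('n \<Rightarrow> real^'d \<Rightarrow> ereal) \<Rightarrow> real
      \<Rightarrow> real^('n::finite \<times> 'd::finite) \<Rightarrow> real^('n \<times> 'd) \<Rightarrow> ereal" where
  "lagrangian M f g \<rho> x y =
     ereal (sep_sum f x) + sep_sum g x + ereal (y \<bullet> (psd_sqrt M *v x))
       + ereal (\<rho> / 2 * (x \<bullet> (M *v x)))"

definition saddle_point_on ::
    "'a set \<Rightarrow> 'b set \<Rightarrow> ('a \<Rightarrow> 'b \<Rightarrow> ereal) \<Rightarrow> 'a \<Rightarrow> 'b \<Rightarrow> bool" where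
  "saddle_point_on X Y \<Phi> x0 y0 \<longleftrightarrow> x0 \<in> X \<and> y0 \<in> Y \<and>
     (\<forall>x\<in>X. \<forall>y\<in>Y. \<Phi> x0 y \<le> \<Phi> x0 y0 \<and> \<Phi> x0 y0 \<le> \<Phi> x y0)"

end

theory Submission
  imports Defs
begin

text \<open>The iteration is a proximal point step with gradient correction in the quadratic form
  \<open>P(u, e) = |u|\<^sup>2/\<alpha> - 2 e \<bullet> S u + |e|\<^sup>2/\<beta>\<close>. The prox inequality, the convexity and smoothness of \<open>f\<close>
  and the dual update give, with \<open>u\<^sub>k = x\<^sub>k - x\<^sup>*\<close> and \<open>e\<^sub>k = y\<^sub>k - y\<^sup>*\<close>, that the gap at step
  \<open>k + 1\<close> is at most \<open>(P(u\<^sub>k, e\<^sub>k) - P(u\<^sub>k\<^sub>+\<^sub>1, e\<^sub>k\<^sub>+\<^sub>1)) / 2\<close>; the step-size condition absorbs the error terms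
  \<open>L\<^sub>f |x\<^sub>k\<^sub>+\<^sub>1 - x\<^sub>k|\<^sup>2\<close> and \<open>\<rho> |S (x\<^sub>k\<^sub>+\<^sub>1 - x\<^sub>k)|\<^sup>2\<close> and makes \<open>P\<close> nonnegative. The sum telescopes,
  the cross term of \<open>P(u\<^sub>0, e\<^sub>0)\<close> vanishes because \<open>S x\<^sub>0 = S x\<^sup>* = 0\<close>, and Jensen's inequality passes
  to the averages. That \<open>S\<close> is well defined and \<open>|S x|\<^sup>2 \<le> \<lambda>\<^sub>n |x|\<^sup>2\<close> comes from the spectral theorem,
  proved by maximizing the Rayleigh quotient on invariant subspaces.\<close>

subsection \<open>Symmetric matrices and the positive semidefinite square root\<close>

lemma symmetric_matrix_iff_selfadjoint:
  fixes A :: "real^'n^'n"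
  shows "transpose A = A \<longleftrightarrow> (\<forall>x y. x \<bullet> (A *v y) = (A *v x) \<bullet> y)"
proof -
  have *: "x \<bullet> (A *v y) = (transpose A *v x) \<bullet> y" for x y
    by (simp add: dot_lmul_matrix[symmetric])
  show ?thesis
  proof
    assume "\<forall>x y. x \<bullet> (A *v y) = (A *v x) \<bullet> y"
    then have "(transpose A *v x) \<bullet> y = (A *v x) \<bullet> y" for x y
      using * by metis
    then have "transpose A *v x = A *v x" for x
      by (metis vector_eq_rdot)
    then show "transpose A = A"
      by (simp add: matrix_eq)
  qed (metis *)
qed

text \<open>A nonnegative form attains its minimum at \<open>v\<close>, and moving from
  \<open>v\<close> against \<open>A *v v\<close> would decrease it to first order. It is stated on
  an invariant subspace so that it can replace the derivative test for Rayleigh quotients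
  there.\<close>

lemma psd_on_quadratic_form_zero:
  fixes A :: "real^'n^'n"
  assumes sym: "\<And>x y. x \<bullet> (A *v y) = (A *v x) \<bullet> y"
    and V: "subspace V" "\<And>x. x \<in> V \<Longrightarrow> A *v x \<in> V"
    and nonneg: "\<And>x. x \<in> V \<Longrightarrow> 0 \<le> x \<bullet> (A *v x)"
    and v: "v \<in> V" "v \<bullet> (A *v v) = 0"
  shows "A *v v = 0"
proof (rule ccontr)
  assume "A *v v \<noteq> 0"
  define w where "w = A *v v"
  define q where "q = w \<bullet> (A *v w)"
  have wV: "w \<in> V" and w: "w \<bullet> w > 0"
    using V v \<open>A *v v \<noteq> 0\<close> by (auto simp: w_def)
  have q: "0 \<le> q" using nonneg wV by (simp add: q_def)
  \<comment> \<open>The \<open>+ 1\<close> keeps the step defined when \<open>q = 0\<close>; this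
    step gives \<open>t * q \<le> w \<bullet> w\<close>, which contradicts the lower bound
    \<open>2 * (w \<bullet> w)\<close>.\<close>
  define t where "t = (w \<bullet> w) / (q + 1)"
  have t: "t > 0" using w q by (simp add: t_def)
  have vw: "v \<bullet> (A *v w) = w \<bullet> w" using sym by (simp add: w_def)
  have "v - t *\<^sub>R w \<in> V" using V v wV by (simp add: subspace_diff subspace_scale)
  then have "0 \<le> (v - t *\<^sub>R w) \<bullet> (A *v (v - t *\<^sub>R w))" by (rule nonneg)
  also have "\<dots> = t * (t * q - 2 * (w \<bullet> w))"
    using v vw by (simp add: matrix_vector_mult_diff_distrib matrix_vector_mult_scaleR
        inner_diff_left inner_diff_right q_def w_def[symmetric] algebra_simps)
  finally have "2 * (w \<bullet> w) \<le> t * q"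
    using t by (simp add: zero_le_mult_iff)
  also have "\<dots> \<le> t * (q + 1)" using t by simp
  also have "\<dots> = w \<bullet> w" using q by (simp add: t_def)
  finally show False using w by simp
qed

text \<open>Compactness of the unit sphere of \<open>V\<close> yields a maximizer \<open>v\<close>
  with value \<open>c\<close>. The form of \<open>c I - A\<close> is then nonnegative on
  \<open>V\<close> and vanishes at \<open>v\<close>, so \<open>v\<close> lies in the kernel of
  \<open>c I - A\<close>.\<close>

lemma rayleigh_maximizer:
  fixes A :: "real^'n^'n"
  assumes sym: "\<And>x y. x \<bullet> (A *v y) = (A *v x) \<bullet> y"
    and V: "subspace V" "\<And>x. x \<in> V \<Longrightarrow> A *v x \<in> V" and ne: "V \<noteq> {0}"
  obtains v c where "v \<in> V" "norm v = 1" "A *v v = c *\<^sub>R v"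
    "\<And>x. x \<in> V \<Longrightarrow> x \<bullet> (A *v x) \<le> c * (x \<bullet> x)"
proof -
  let ?K = "V \<inter> sphere 0 1"
  obtain u where u: "u \<in> V" "u \<noteq> 0"
    using ne subspace_0[OF V(1)] by auto
  have "u /\<^sub>R norm u \<in> ?K" using u V by (simp add: subspace_scale)
  then have "?K \<noteq> {}" by blast
  moreover have "compact ?K"
    using closed_subspace[OF V(1)] by (simp add: compact_Int_closed closed_Int_compact)
  moreover have "continuous_on ?K (\<lambda>x. x \<bullet> (A *v x))"
    by (intro continuous_intros linear_continuous_on)
       (simp add: linear_conv_bounded_linear[symmetric])
  ultimately obtain v where v: "v \<in> ?K"
    and max: "\<And>x. x \<in> ?K \<Longrightarrow> x \<bullet> (A *v x) \<le> v \<bullet> (A *v v)"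
    using continuous_attains_sup[of ?K "\<lambda>x. x \<bullet> (A *v x)"] by blast
  define c where "c = v \<bullet> (A *v v)"
  have bound: "x \<bullet> (A *v x) \<le> c * (x \<bullet> x)" if "x \<in> V" for x
  proof (cases "x = 0")
    case False
    have "x /\<^sub>R norm x \<in> ?K" using that False V by (simp add: subspace_scale)
    from max[OF this] show ?thesis using False
      by (simp add: c_def matrix_vector_mult_scaleR divide_simps dot_square_norm power2_eq_square algebra_simps)
  qed simp
  let ?B = "c *\<^sub>R mat 1 - A"
  have B: "?B *v x = c *\<^sub>R x - A *v x" for x
    by (simp add: matrix_vector_mult_diff_rdistrib scaleR_matrix_vector_assoc[symmetric])
  have vv: "v \<bullet> v = 1" using v by (simp add: dot_square_norm)
  have "?B *v v = 0"
  proof (rule psd_on_quadratic_form_zero[where V = V])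
    show "x \<bullet> (?B *v y) = (?B *v x) \<bullet> y" for x y
      using sym by (simp add: B inner_diff_left inner_diff_right)
    show "?B *v x \<in> V" if "x \<in> V" for x
      using that V by (simp add: B subspace_diff subspace_scale)
    show "0 \<le> x \<bullet> (?B *v x)" if "x \<in> V" for x
      using bound[OF that] by (simp add: B inner_diff_right)
    show "v \<bullet> (?B *v v) = 0" unfolding B using vv by (simp add: inner_diff_right c_def)
  qed (use v V in auto)
  then show ?thesis using that[of v c] v bound by (simp add: B)
qed

text \<open>Induction on the dimension: a Rayleigh maximizer \<open>v\<close> is split off, and its
  orthogonal complement \<open>W\<close> inside \<open>V\<close> is again invariant because
  \<open>A\<close> is self-adjoint.\<close>

lemma spectral_decomposition_subspace:
  fixes A :: "real^'n^'n"
  assumes sym: "\<And>x y. x \<bullet> (A *v y) = (A *v x) \<bullet> y"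
    and "subspace V" "\<And>x. x \<in> V \<Longrightarrow> A *v x \<in> V"
  shows "\<exists>B c. finite B \<and> B \<subseteq> V \<and> (\<forall>b\<in>B. \<forall>b'\<in>B. b \<bullet> b' = (if b = b' then 1 else 0)) \<and>
    (\<forall>b\<in>B. A *v b = c b *\<^sub>R b) \<and> (\<forall>x\<in>V. x = (\<Sum>b\<in>B. (x \<bullet> b) *\<^sub>R b))"
  using assms(2,3)
proof (induction "dim V" arbitrary: V rule: less_induct)
  case less
  show ?case
  proof (cases "V = {0}")
    case True
    then show ?thesis by (intro exI[of _ "{}"]) auto
  next
    case False
    obtain v c where v: "v \<in> V" "norm v = 1" "A *v v = c *\<^sub>R v"
      using rayleigh_maximizer[OF sym less.prems False] by metis
    have vv: "v \<bullet> v = 1" using v by (simp add: dot_square_norm)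
    define W where "W = {x\<in>V. v \<bullet> x = 0}"
    have W: "subspace W"
      using less.prems(1) by (auto simp: W_def subspace_def inner_add_right)
    have inv: "A *v x \<in> W" if "x \<in> W" for x
      using that less.prems sym[of v x] by (simp add: W_def v)
    have "v \<notin> W" using vv by (simp add: W_def)
    then have "W \<subset> V" using v(1) unfolding W_def by blast
    then have "dim W < dim V"
      using W less.prems(1) by (metis dim_psubset span_eq_iff)
    from less.hyps[OF this W inv] obtain B e where B: "finite B" "B \<subseteq> W"
      "\<forall>b\<in>B. \<forall>b'\<in>B. b \<bullet> b' = (if b = b' then 1 else 0)"
      "\<forall>b\<in>B. A *v b = e b *\<^sub>R b" "\<forall>x\<in>W. x = (\<Sum>b\<in>B. (x \<bullet> b) *\<^sub>R b)"
      by blast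
    have vB: "v \<notin> B" using \<open>v \<notin> W\<close> B by blast
    have orth: "v \<bullet> b = 0" if "b \<in> B" for b using that B by (auto simp: W_def)
    have exp: "x = (\<Sum>b\<in>insert v B. (x \<bullet> b) *\<^sub>R b)" if "x \<in> V" for x
    proof -
      \<comment> \<open>Removing the component along \<open>v\<close> lands in \<open>W\<close>,
        where the induction hypothesis applies; the coefficients at \<open>b \<in> B\<close> do not
        change, since \<open>v\<close> is orthogonal to \<open>B\<close>.\<close>
      have "x - (x \<bullet> v) *\<^sub>R v \<in> W"
        using that v vv less.prems(1)
        by (simp add: W_def subspace_diff subspace_scale inner_diff_right inner_commute)
      then have "x - (x \<bullet> v) *\<^sub>R v = (\<Sum>b\<in>B. ((x - (x \<bullet> v) *\<^sub>R v) \<bullet> b) *\<^sub>R b)"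
        using B by blast
      also have "\<dots> = (\<Sum>b\<in>B. (x \<bullet> b) *\<^sub>R b)"
        by (rule sum.cong) (auto simp: inner_diff_left orth)
      finally show ?thesis using B vB by (simp add: algebra_simps)
    qed
    have "b \<bullet> b' = (if b = b' then 1 else 0)" if "b \<in> insert v B" "b' \<in> insert v B" for b b'
      using that B(3) vv vB orth by (auto simp: inner_commute)
    moreover have "A *v b = (e(v := c)) b *\<^sub>R b" if "b \<in> insert v B" for b
      using that B(4) v(3) vB by auto
    moreover have "finite (insert v B)" "insert v B \<subseteq> V"
      using B(1,2) v(1) by (auto simp: W_def)
    ultimately show ?thesis
      by (intro exI[of _ "insert v B"] exI[of _ "e(v := c)"] conjI ballI) (assumption | rule exp)+
  qed
qed

lemma spectral_decomposition:
  fixes A :: "real^'n^'n"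
  assumes "transpose A = A"
  obtains B c where "finite B" "\<And>b b'. b \<in> B \<Longrightarrow> b' \<in> B \<Longrightarrow> b \<bullet> b' = (if b = b' then 1 else 0)"
    "\<And>b. b \<in> B \<Longrightarrow> A *v b = c b *\<^sub>R b" "\<And>x. x = (\<Sum>b\<in>B. (x \<bullet> b) *\<^sub>R b)"
proof -
  have "x \<bullet> (A *v y) = (A *v x) \<bullet> y" for x y
    using assms symmetric_matrix_iff_selfadjoint by blast
  from spectral_decomposition_subspace[OF this, of UNIV]
  obtain B c where "finite B" "\<forall>b\<in>B. \<forall>b'\<in>B. b \<bullet> b' = (if b = b' then 1 else 0)"
    "\<forall>b\<in>B. A *v b = c b *\<^sub>R b" "\<forall>x\<in>UNIV. x = (\<Sum>b\<in>B. (x \<bullet> b) *\<^sub>R b)"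
    by auto
  then show ?thesis by (intro that[of B c]) blast+
qed

text \<open>\<open>largest_eigenvalue\<close> is a \<open>Max\<close>, which is meaningful only on a
  finite set. An eigenvector has a nonzero coefficient at some \<open>b\<close>, and
  self-adjointness forces its eigenvalue to be \<open>e b\<close>.\<close>

lemma finite_eigenvalues:
  fixes A :: "real^'n^'n"
  assumes "transpose A = A"
  shows "finite {c. is_eigenvalue A c}"
proof -
  obtain B e where B: "finite B" "\<And>b. b \<in> B \<Longrightarrow> A *v b = e b *\<^sub>R b"
    "\<And>x. x = (\<Sum>b\<in>B. (x \<bullet> b) *\<^sub>R b)"
    by (rule spectral_decomposition[OF assms]) blast
  have "c \<in> e ` B" if c: "is_eigenvalue A c" for c
  proof -
    obtain v where v: "v \<noteq> 0" "A *v v = c *\<^sub>R v" using c by (auto simp: is_eigenvalue_def)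
    have "\<exists>b\<in>B. v \<bullet> b \<noteq> 0"
    proof (rule ccontr)
      assume "\<not> ?thesis"
      then have "(\<Sum>b\<in>B. (v \<bullet> b) *\<^sub>R b) = 0" by simp
      then show False using B(3)[of v] v(1) by argo
    qed
    then obtain b where b: "b \<in> B" "v \<bullet> b \<noteq> 0" by blast
    have "c * (v \<bullet> b) = (A *v v) \<bullet> b" using v by simp
    also have "\<dots> = v \<bullet> (A *v b)" using assms symmetric_matrix_iff_selfadjoint by metis
    also have "\<dots> = e b * (v \<bullet> b)" using b B by simp
    finally show ?thesis using b by auto
  qed
  then show ?thesis using B(1) by (blast intro: finite_subset[of _ "e ` B"])
qed

text \<open>The maximal Rayleigh quotient is itself an eigenvalue, hence at most the largest
  one.\<close>

lemma quadratic_form_le_largest_eigenvalue: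
  fixes A :: "real^'n^'n"
  assumes "transpose A = A"
  shows "x \<bullet> (A *v x) \<le> largest_eigenvalue A * (x \<bullet> x)"
proof -
  have sym: "x \<bullet> (A *v y) = (A *v x) \<bullet> y" for x y
    using assms symmetric_matrix_iff_selfadjoint by blast
  have "(UNIV :: (real^'n) set) \<noteq> {0}"
    using UNIV_not_singleton by blast
  then obtain v c where v: "norm v = 1" "A *v v = c *\<^sub>R v"
    and bound: "\<And>x. x \<bullet> (A *v x) \<le> c * (x \<bullet> x)"
    using rayleigh_maximizer[OF sym, of UNIV] by (metis UNIV_I subspace_UNIV)
  have "is_eigenvalue A c" using v by (auto simp: is_eigenvalue_def intro!: exI[of _ v])
  then have "c \<le> largest_eigenvalue A"
    using finite_eigenvalues[OF assms] by (simp add: largest_eigenvalue_def)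
  then have "c * (x \<bullet> x) \<le> largest_eigenvalue A * (x \<bullet> x)"
    by (simp add: mult_right_mono)
  with bound[of x] show ?thesis by linarith
qed

text \<open>Take square roots of the eigenvalues in an orthonormal eigenbasis. \<open>S ** S\<close>
  and \<open>A\<close> agree on the basis, hence everywhere.\<close>

lemma psd_sqrt_exists:
  fixes A :: "real^'n^'n"
  assumes "pos_semidef A"
  shows "\<exists>S. pos_semidef S \<and> S ** S = A"
proof -
  have symA: "transpose A = A" and nonneg: "\<And>x. 0 \<le> x \<bullet> (A *v x)"
    using assms by (auto simp: pos_semidef_def)
  obtain B e where B: "finite B"
    and orth: "\<And>b b'. b \<in> B \<Longrightarrow> b' \<in> B \<Longrightarrow> b \<bullet> b' = (if b = b' then 1 else 0)"
    and eig: "\<And>b. b \<in> B \<Longrightarrow> A *v b = e b *\<^sub>R b" and exp: "\<And>x. x = (\<Sum>b\<in>B. (x \<bullet> b) *\<^sub>R b)"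
    by (rule spectral_decomposition[OF symA]) blast
  have e: "0 \<le> e b" if "b \<in> B" for b
    using nonneg[of b] orth[OF that that] by (simp add: eig that)
  define s where "s x = (\<Sum>b\<in>B. (sqrt (e b) * (x \<bullet> b)) *\<^sub>R b)" for x
  have "linear s"
    by (rule linearI)
      (simp_all add: s_def inner_add_left algebra_simps sum.distrib scaleR_sum_right)
  define S where "S = matrix s"
  have S: "S *v x = s x" for x
    using \<open>linear s\<close> by (simp add: S_def matrix_works)
  have s_inner: "y \<bullet> s x = (\<Sum>b\<in>B. sqrt (e b) * (x \<bullet> b) * (y \<bullet> b))" for x y
    by (simp add: s_def inner_sum_right)
  have "y \<bullet> s x = s y \<bullet> x" for x y
    by (subst inner_commute[of "s y"]) (simp add: s_inner mult_ac)
  then have "transpose S = S"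
    by (simp add: symmetric_matrix_iff_selfadjoint S)
  moreover have "0 \<le> x \<bullet> s x" for x
    by (simp add: s_inner sum_nonneg e mult.assoc)
  ultimately have "pos_semidef S" by (simp add: pos_semidef_def S)
  have sb: "s b = sqrt (e b) *\<^sub>R b" if "b \<in> B" for b
  proof -
    have "s b = (\<Sum>b'\<in>B. if b' = b then sqrt (e b) *\<^sub>R b else 0)"
      unfolding s_def by (rule sum.cong) (use orth that in auto)
    then show ?thesis using B that by simp
  qed
  have SS: "S *v (S *v b) = A *v b" if "b \<in> B" for b
    using that e[OF that] by (simp add: S[of b] sb matrix_vector_mult_scaleR eig)
  have lin: "linear (\<lambda>x. S *v (S *v x))"
    using linear_compose[of "(*v) S" "(*v) S"] by (simp add: o_def)
  have "(S ** S) *v x = A *v x" for x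
  proof -
    have "(S ** S) *v x = S *v (S *v (\<Sum>b\<in>B. (x \<bullet> b) *\<^sub>R b))"
      using arg_cong[OF exp[of x], of "\<lambda>z. S *v (S *v z)"] by (simp only: matrix_vector_mul_assoc)
    also have "\<dots> = (\<Sum>b\<in>B. (x \<bullet> b) *\<^sub>R (S *v (S *v b)))"
      by (simp add: linear_sum[OF lin] linear_cmul[OF lin])
    also have "\<dots> = (\<Sum>b\<in>B. (x \<bullet> b) *\<^sub>R (A *v b))"
      by (simp add: SS)
    also have "\<dots> = A *v (\<Sum>b\<in>B. (x \<bullet> b) *\<^sub>R b)"
      by (simp add: linear_sum[OF matrix_vector_mul_linear] matrix_vector_mult_scaleR)
    also have "\<dots> = A *v x" by (rule arg_cong[OF exp[symmetric]])
    finally show ?thesis .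
  qed
  then show ?thesis using \<open>pos_semidef S\<close> matrix_eq by blast
qed

text \<open>For \<open>S\<^sup>2 = T\<^sup>2\<close> and \<open>D = S - T\<close> one has \<open>S D + D T = 0\<close>; testing this on an
  eigenvector of \<open>D\<close> shows that every eigenvalue of \<open>D\<close> vanishes.\<close>

lemma psd_sqrt_unique:
  fixes S T :: "real^'n^'n"
  assumes S: "pos_semidef S" and T: "pos_semidef T" and eq: "S ** S = T ** T"
  shows "S = T"
proof -
  have psd_zero: "P *v v = 0" if "pos_semidef P" "v \<bullet> (P *v v) = 0" for P :: "real^'n^'n" and v
    using that psd_on_quadratic_form_zero[of P UNIV v] symmetric_matrix_iff_selfadjoint[of P]
    by (auto simp: pos_semidef_def)
  have symS: "x \<bullet> (S *v y) = (S *v x) \<bullet> y" and symT: "x \<bullet> (T *v y) = (T *v x) \<bullet> y" for x y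
    using S T symmetric_matrix_iff_selfadjoint unfolding pos_semidef_def by blast+
  let ?D = "S - T"
  have D: "?D *v x = S *v x - T *v x" for x
    by (simp add: matrix_vector_mult_diff_rdistrib)
  have "x \<bullet> (?D *v y) = (?D *v x) \<bullet> y" for x y
    using symS symT by (simp add: D inner_diff_left inner_diff_right)
  note symD = this
  then have "transpose ?D = ?D" using symmetric_matrix_iff_selfadjoint by blast
  then obtain B c where B: "finite B" and eig: "\<And>b. b \<in> B \<Longrightarrow> ?D *v b = c b *\<^sub>R b"
    and exp: "\<And>x. x = (\<Sum>b\<in>B. (x \<bullet> b) *\<^sub>R b)"
    by (rule spectral_decomposition) blast
  have zero: "?D *v b = 0" if "b \<in> B" for b
  proof -
    have "S *v (S *v b) = T *v (T *v b)" using eq by (simp add: matrix_vector_mul_assoc)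
    then have "0 = b \<bullet> (S *v (?D *v b)) + b \<bullet> (?D *v (T *v b))"
      by (simp add: D matrix_vector_mult_diff_distrib inner_diff_right)
    also have "\<dots> = (S *v b) \<bullet> (?D *v b) + (?D *v b) \<bullet> (T *v b)"
      using symS[of b "?D *v b"] symD[of b "T *v b"] by linarith
    also have "\<dots> = c b * (b \<bullet> (S *v b) + b \<bullet> (T *v b))"
      unfolding eig[OF that] by (simp add: inner_commute algebra_simps)
    \<comment> \<open>Either the eigenvalue of \<open>S - T\<close> at \<open>b\<close> is zero, or
      both nonnegative forms vanish at \<open>b\<close>, and then \<open>S\<close> and
      \<open>T\<close> both annihilate \<open>b\<close>.\<close>
    finally have "c b = 0 \<or> b \<bullet> (S *v b) + b \<bullet> (T *v b) = 0" by simp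
    moreover have "0 \<le> b \<bullet> (S *v b)" "0 \<le> b \<bullet> (T *v b)"
      using S T by (auto simp: pos_semidef_def)
    ultimately consider "c b = 0" | "b \<bullet> (S *v b) = 0" "b \<bullet> (T *v b) = 0" by linarith
    then show ?thesis
    proof cases
      case 1
      then show ?thesis by (simp only: eig[OF that] scaleR_zero_left)
    next
      case 2
      then show ?thesis using psd_zero[OF S 2(1)] psd_zero[OF T 2(2)] D by simp
    qed
  qed
  have "?D *v x = 0" for x
  proof -
    have "?D *v x = (\<Sum>b\<in>B. (x \<bullet> b) *\<^sub>R (?D *v b))"
      using arg_cong[OF exp[of x], of "\<lambda>z. ?D *v z"]
      by (simp only: linear_sum[OF matrix_vector_mul_linear] matrix_vector_mult_scaleR)
    then show ?thesis using zero by simp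
  qed
  then show ?thesis by (simp add: D matrix_eq)
qed

text \<open>\<open>psd_sqrt\<close> is a definite description, so its defining properties require
  both existence and uniqueness.\<close>

lemma psd_sqrt_properties:
  fixes A :: "real^'n^'n"
  assumes "pos_semidef A"
  shows "pos_semidef (psd_sqrt A)" "psd_sqrt A ** psd_sqrt A = A"
proof -
  have "\<exists>!S. pos_semidef S \<and> S ** S = A"
    using psd_sqrt_exists[OF assms] psd_sqrt_unique by metis
  from theI'[OF this] show "pos_semidef (psd_sqrt A)" "psd_sqrt A ** psd_sqrt A = A"
    by (auto simp: psd_sqrt_def)
qed

subsection \<open>The graph Laplacian\<close>

lemma laplacian_vector_mult:
  "(laplacian E *v x) $ i = (\<Sum>j\<in>UNIV. adjacency_matrix E $ i $ j * (x $ i - x $ j))"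
proof -
  let ?a = "adjacency_matrix E"
  have "(diag_matrix v *v x) $ i = v $ i * x $ i" for v :: "real^'a"
  proof -
    have "(diag_matrix v *v x) $ i = (\<Sum>j\<in>UNIV. if i = j then v $ j * x $ j else 0)"
      by (auto simp: diag_matrix_def matrix_vector_mult_def if_distrib if_distribR cong: if_cong)
    then show ?thesis by simp
  qed
  then have "(laplacian E *v x) $ i = (?a *v 1) $ i * x $ i - (?a *v x) $ i"
    by (simp add: laplacian_def matrix_vector_mult_diff_rdistrib)
  also have "\<dots> = (\<Sum>j\<in>UNIV. ?a $ i $ j * (x $ i - x $ j))"
    by (simp add: matrix_vector_mult_def sum_distrib_right right_diff_distrib sum_subtractf)
  finally show ?thesis .
qed

text \<open>Averaging the double sum with its copy under exchange of \<open>i\<close> and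
  \<open>j\<close> symmetrizes it. The factor 1/2 appears because an edge is counted as two ordered
  pairs. From this form symmetry and nonnegativity can be read off.\<close>

lemma laplacian_quadratic_form:
  assumes "sym E"
  shows "y \<bullet> (laplacian E *v x) =
    1/2 * (\<Sum>i\<in>UNIV. \<Sum>j\<in>UNIV. adjacency_matrix E $ i $ j * ((y $ i - y $ j) * (x $ i - x $ j)))"
proof -
  let ?a = "adjacency_matrix E"
  have a: "?a $ i $ j = ?a $ j $ i" for i j
    using assms by (auto simp: adjacency_matrix_def sym_def)
  let ?s = "\<Sum>i\<in>UNIV. \<Sum>j\<in>UNIV. ?a $ i $ j * (y $ i * (x $ i - x $ j))"
  have s: "y \<bullet> (laplacian E *v x) = ?s"
    by (simp add: inner_vec_def laplacian_vector_mult sum_distrib_left mult_ac)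
  have "?s = (\<Sum>j\<in>UNIV. \<Sum>i\<in>UNIV. ?a $ i $ j * (y $ i * (x $ i - x $ j)))" by (rule sum.swap)
  also have "\<dots> = (\<Sum>i\<in>UNIV. \<Sum>j\<in>UNIV. ?a $ i $ j * (y $ j * (x $ j - x $ i)))"
    by (simp add: a)
  finally have "?s + ?s = (\<Sum>i\<in>UNIV. \<Sum>j\<in>UNIV. ?a $ i $ j * (y $ i * (x $ i - x $ j)))
      + (\<Sum>i\<in>UNIV. \<Sum>j\<in>UNIV. ?a $ i $ j * (y $ j * (x $ j - x $ i)))" by simp
  also have "\<dots> = (\<Sum>i\<in>UNIV. \<Sum>j\<in>UNIV. ?a $ i $ j * ((y $ i - y $ j) * (x $ i - x $ j)))"
    by (simp add: sum.distrib[symmetric] algebra_simps)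
  finally show ?thesis using s by simp
qed

lemma pos_semidef_laplacian:
  assumes "sym E"
  shows "pos_semidef (laplacian E)"
proof -
  have "y \<bullet> (laplacian E *v x) = x \<bullet> (laplacian E *v y)" for x y
    by (simp add: laplacian_quadratic_form[OF assms] mult.commute)
  then have "transpose (laplacian E) = laplacian E"
    unfolding symmetric_matrix_iff_selfadjoint by (metis inner_commute)
  moreover have "0 \<le> x \<bullet> (laplacian E *v x)" for x
    unfolding laplacian_quadratic_form[OF assms]
    by (simp add: sum_nonneg adjacency_matrix_def)
  ultimately show ?thesis by (simp add: pos_semidef_def)
qed

section \<open>Kronecker products with the identity\<close>

lemma sum_prod_UNIV:
  "(\<Sum>p\<in>UNIV. h p) = (\<Sum>i\<in>UNIV. \<Sum>j\<in>UNIV. h (i::'a::finite, j::'b::finite))"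
  using sum.cartesian_product[of "\<lambda>i j. h (i, j)" UNIV UNIV] by (simp add: UNIV_Times_UNIV)

lemma kronecker_identity_vector_mult:
  fixes L :: "real^'n^'n" and x :: "real^('n \<times> 'd::finite)"
  shows "((L \<otimes>\<^sub>K mat 1) *v x) $ (i, k) = (L *v (\<chi> j. x $ (j, k))) $ i"
proof -
  have "((L \<otimes>\<^sub>K mat 1) *v x) $ (i, k) =
      (\<Sum>j\<in>UNIV. \<Sum>l\<in>UNIV. if k = l then L $ i $ j * x $ (j, l) else 0)"
    unfolding matrix_vector_mult_def kronecker_product_def mat_def sum_prod_UNIV vec_lambda_beta
    by (intro sum.cong refl) simp
  then show ?thesis by (simp add: matrix_vector_mult_def)
qed

text \<open>\<open>L \<otimes>\<^sub>K mat 1\<close> acts separately on each slice that collects the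
  \<open>k\<close>-th coordinates of all blocks. Positivity and spectral bounds thus pass from
  \<open>L\<close> to the product slice by slice, without computing eigenvalues of the
  product.\<close>

lemma kronecker_identity_inner:
  fixes L :: "real^'n^'n" and x y :: "real^('n \<times> 'd::finite)"
  shows "y \<bullet> ((L \<otimes>\<^sub>K mat 1) *v x) =
    (\<Sum>k\<in>UNIV. (\<chi> j. y $ (j, k)) \<bullet> (L *v (\<chi> j. x $ (j, k))))"
proof -
  have "y \<bullet> ((L \<otimes>\<^sub>K mat 1) *v x) =
      (\<Sum>i\<in>UNIV. \<Sum>k\<in>UNIV. y $ (i, k) * (L *v (\<chi> j. x $ (j, k))) $ i)"
    by (simp add: inner_vec_def sum_prod_UNIV kronecker_identity_vector_mult)
  also have "\<dots> = (\<Sum>k\<in>UNIV. \<Sum>i\<in>UNIV. y $ (i, k) * (L *v (\<chi> j. x $ (j, k))) $ i)"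
    by (rule sum.swap)
  finally show ?thesis by (simp add: inner_vec_def)
qed

lemma pos_semidef_kronecker_identity:
  fixes L :: "real^'n^'n"
  assumes "pos_semidef L"
  shows "pos_semidef (L \<otimes>\<^sub>K (mat 1 :: real^'d::finite^'d))"
proof -
  have sym: "x \<bullet> (L *v y) = (L *v x) \<bullet> y" for x y
    using assms symmetric_matrix_iff_selfadjoint unfolding pos_semidef_def by blast
  have "y \<bullet> ((L \<otimes>\<^sub>K mat 1) *v x) = x \<bullet> ((L \<otimes>\<^sub>K mat 1) *v y)" for x y :: "real^('n \<times> 'd)"
    unfolding kronecker_identity_inner by (rule sum.cong[OF refl]) (metis sym inner_commute)
  then have "transpose (L \<otimes>\<^sub>K (mat 1 :: real^'d::finite^'d)) = L \<otimes>\<^sub>K mat 1"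
    unfolding symmetric_matrix_iff_selfadjoint by (metis inner_commute)
  then show ?thesis
    using assms by (auto simp: pos_semidef_def kronecker_identity_inner intro!: sum_nonneg)
qed

lemma kronecker_identity_quadratic_form_le:
  fixes L :: "real^'n^'n" and x :: "real^('n \<times> 'd::finite)"
  assumes "transpose L = L"
  shows "x \<bullet> ((L \<otimes>\<^sub>K mat 1) *v x) \<le> largest_eigenvalue L * (x \<bullet> x)"
proof -
  have "x \<bullet> ((L \<otimes>\<^sub>K mat 1) *v x) \<le>
      (\<Sum>k\<in>UNIV. largest_eigenvalue L * ((\<chi> j. x $ (j, k)) \<bullet> (\<chi> j. x $ (j, k))))"
    unfolding kronecker_identity_inner
    by (rule sum_mono) (rule quadratic_form_le_largest_eigenvalue[OF assms])
  also have "\<dots> = largest_eigenvalue L * (\<Sum>k\<in>UNIV. \<Sum>j\<in>UNIV. x $ (j, k) * x $ (j, k))"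
    by (simp add: inner_vec_def sum_distrib_left)
  also have "(\<Sum>k\<in>UNIV. \<Sum>j\<in>UNIV. x $ (j, k) * x $ (j, k)) =
      (\<Sum>j\<in>UNIV. \<Sum>k\<in>UNIV. x $ (j, k) * x $ (j, k))"
    by (rule sum.swap)
  also have "\<dots> = x \<bullet> x"
    by (simp add: inner_vec_def sum_prod_UNIV)
  finally show ?thesis .
qed

subsection \<open>Smooth and separable convex functions\<close>

lemma block_inner_sum: "x \<bullet> y = (\<Sum>i\<in>UNIV. block i x \<bullet> block i y)"
proof -
  have "x \<bullet> y = (\<Sum>p\<in>UNIV \<times> UNIV. x $ p * y $ p)"
    by (simp add: inner_vec_def)
  also have "\<dots> = (\<Sum>i\<in>UNIV. \<Sum>j\<in>UNIV. x $ (i, j) * y $ (i, j))"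
    by (simp add: sum.cartesian_product case_prod_unfold)
  finally show ?thesis by (simp add: block_def inner_vec_def)
qed

lemma block_linear: "linear (block i)"
  by (rule linearI) (simp_all add: block_def vec_eq_iff)

lemmas block_simps =
  linear_add[OF block_linear] linear_diff[OF block_linear] linear_cmul[OF block_linear]

lemma block_stack [simp]: "block i (stack v) = v i"
  by (simp add: block_def stack_def vec_eq_iff)

text \<open>\<open>grad\<close> is a definite description: the Riesz representative \<open>D\<close>
  of the derivative gives existence, and uniqueness of derivatives gives the rest.\<close>

lemma GDERIV_grad:
  fixes h :: "'a::euclidean_space \<Rightarrow> real"
  assumes "h differentiable at x"
  shows "GDERIV h x :> grad h x"
proof -
  obtain h' where h': "(h has_derivative h') (at x)"
    using assms by (auto simp: differentiable_def)
  interpret bounded_linear h' using h' by (rule has_derivative_bounded_linear)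
  define D where "D = (\<Sum>b\<in>Basis. h' b *\<^sub>R b)"
  have "h' v = v \<bullet> D" for v
  proof -
    have "h' v = h' (\<Sum>b\<in>Basis. (v \<bullet> b) *\<^sub>R b)" by (simp add: euclidean_representation)
    also have "\<dots> = (\<Sum>b\<in>Basis. (v \<bullet> b) * h' b)" by (simp add: sum scaleR)
    finally show ?thesis by (simp add: D_def inner_sum_right mult.commute)
  qed
  then have "h' = (\<lambda>v. v \<bullet> D)" by blast
  then have D: "GDERIV h x :> D" using h' by (simp add: gderiv_def)
  moreover have "D' = D" if "GDERIV h x :> D'" for D'
  proof -
    have "(\<lambda>v. v \<bullet> D') = (\<lambda>v. v \<bullet> D)"
      using that D unfolding gderiv_def by (rule has_derivative_unique)
    then show ?thesis by (metis vector_eq_ldot)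
  qed
  ultimately show ?thesis unfolding grad_def by (rule theI)
qed

lemma DERIV_along_line:
  fixes h :: "'a::euclidean_space \<Rightarrow> real"
  assumes "h differentiable_on UNIV"
  shows "((\<lambda>t. h (x + t *\<^sub>R v)) has_real_derivative v \<bullet> grad h (x + t *\<^sub>R v)) (at t)"
proof -
  have "(h has_derivative (\<lambda>u. u \<bullet> grad h (x + t *\<^sub>R v))) (at (x + t *\<^sub>R v))"
    using GDERIV_grad assms by (auto simp: gderiv_def differentiable_on_def)
  moreover have "((\<lambda>t. x + t *\<^sub>R v) has_derivative (\<lambda>s. s *\<^sub>R v)) (at t)"
    by (auto intro!: derivative_eq_intros)
  ultimately have "((\<lambda>t. h (x + t *\<^sub>R v)) has_derivative
      (\<lambda>s. (s *\<^sub>R v) \<bullet> grad h (x + t *\<^sub>R v))) (at t)"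
    using has_derivative_compose by fastforce
  then show ?thesis
    by (simp add: has_field_derivative_def mult_commute_abs)
qed

text \<open>Restriction to the line through \<open>x\<close> and \<open>y\<close> reduces this to
  the tangent inequality in one variable.\<close>

lemma convex_on_above_gradient:
  fixes h :: "'a::euclidean_space \<Rightarrow> real"
  assumes "convex_on UNIV h" "h differentiable_on UNIV"
  shows "h x + (y - x) \<bullet> grad h x \<le> h y"
proof -
  let ?\<phi> = "\<lambda>t. h (x + t *\<^sub>R (y - x))"
  have "convex_on UNIV ?\<phi>"
  proof (rule convex_onI)
    fix t a b :: real assume t: "0 < t" "t < 1"
    have "x + ((1 - t) *\<^sub>R a + t *\<^sub>R b) *\<^sub>R (y - x) =
        (1 - t) *\<^sub>R (x + a *\<^sub>R (y - x)) + t *\<^sub>R (x + b *\<^sub>R (y - x))"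
      by (simp add: algebra_simps)
    then show "?\<phi> ((1 - t) *\<^sub>R a + t *\<^sub>R b) \<le> (1 - t) * ?\<phi> a + t * ?\<phi> b"
      using convex_onD[OF assms(1), of t "x + a *\<^sub>R (y - x)" "x + b *\<^sub>R (y - x)"] t by simp
  qed simp
  moreover have "(?\<phi> has_real_derivative (y - x) \<bullet> grad h x) (at 0)"
    using DERIV_along_line[OF assms(2), of x "y - x" 0] by simp
  ultimately have "(y - x) \<bullet> grad h x * (1 - 0) \<le> ?\<phi> 1 - ?\<phi> 0"
    by (intro convex_on_imp_above_tangent[of UNIV]) auto
  then show ?thesis by simp
qed

text \<open>Along the segment, \<open>h\<close> minus its claimed quadratic majorant is
  nonincreasing: Cauchy-Schwarz and the Lipschitz bound make its derivative at most zero.\<close>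

lemma descent_lemma:
  fixes h :: "'a::euclidean_space \<Rightarrow> real"
  assumes diff: "h differentiable_on UNIV" and lip: "l-lipschitz_on UNIV (grad h)"
  shows "h y \<le> h x + (y - x) \<bullet> grad h x + l / 2 * ((y - x) \<bullet> (y - x))"
proof -
  define v where "v = y - x"
  let ?\<phi> = "\<lambda>t. h (x + t *\<^sub>R v) - t * (v \<bullet> grad h x) - l / 2 * t\<^sup>2 * (v \<bullet> v)"
  have "?\<phi> 1 \<le> ?\<phi> 0"
  proof (rule DERIV_nonpos_imp_nonincreasing[where f = ?\<phi>])
    fix t :: real assume t: "0 \<le> t" "t \<le> 1"
    have "norm (grad h (x + t *\<^sub>R v) - grad h x) \<le> l * (t * norm v)"
      using lipschitz_onD[OF lip, of "x + t *\<^sub>R v" x] t by (simp add: dist_norm)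
    then have "v \<bullet> (grad h (x + t *\<^sub>R v) - grad h x) \<le> norm v * (l * (t * norm v))"
      by (meson norm_cauchy_schwarz mult_left_mono norm_ge_zero order_trans)
    also have "\<dots> = l * t * (v \<bullet> v)"
      by (simp add: dot_square_norm power2_eq_square)
    finally have "v \<bullet> grad h (x + t *\<^sub>R v) - v \<bullet> grad h x - l * t * (v \<bullet> v) \<le> 0"
      by (simp add: inner_diff_right)
    moreover have "(?\<phi> has_real_derivative
        v \<bullet> grad h (x + t *\<^sub>R v) - v \<bullet> grad h x - l * t * (v \<bullet> v)) (at t)"
      by (rule derivative_eq_intros DERIV_along_line[OF diff] refl | simp)+
    ultimately show "\<exists>d. (?\<phi> has_real_derivative d) (at t) \<and> d \<le> 0" by blast
  qed simp
  then show ?thesis by (simp add: v_def)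
qed

text \<open>Both the tangent inequality and the descent inequality are taken at \<open>u\<close>, the point where
  the gradient is evaluated.\<close>

lemma sep_sum_three_point:
  fixes f :: "'n::finite \<Rightarrow> real^'d::finite \<Rightarrow> real"
  assumes conv: "\<And>i. convex_on UNIV (f i)" and diff: "\<And>i. f i differentiable_on UNIV"
    and lip: "\<And>i. (Lc i)-lipschitz_on UNIV (grad (f i))"
  shows "sep_sum f w \<le> sep_sum f z + (w - z) \<bullet> sep_grad f u
    + Max (range Lc) / 2 * ((w - u) \<bullet> (w - u))"
proof -
  have "f i (block i w) \<le> f i (block i z) + (block i (w - z)) \<bullet> grad (f i) (block i u)
      + Max (range Lc) / 2 * (block i (w - u) \<bullet> block i (w - u))" for i
  proof -
    have "Lc i / 2 * (block i (w - u) \<bullet> block i (w - u))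
        \<le> Max (range Lc) / 2 * (block i (w - u) \<bullet> block i (w - u))"
      by (intro mult_right_mono) auto
    moreover note descent_lemma[OF diff lip, of i "block i w" "block i u"]
      convex_on_above_gradient[OF conv diff, of i "block i u" "block i z"]
    ultimately show ?thesis by (simp add: block_simps inner_diff_left)
  qed
  then have "sep_sum f w \<le> (\<Sum>i\<in>UNIV. f i (block i z)
      + (block i (w - z)) \<bullet> grad (f i) (block i u)
      + Max (range Lc) / 2 * (block i (w - u) \<bullet> block i (w - u)))"
    unfolding sep_sum_def by (intro sum_mono)
  also have "\<dots> = sep_sum f z + (w - z) \<bullet> sep_grad f u
      + Max (range Lc) / 2 * ((w - u) \<bullet> (w - u))"
    by (simp add: sep_sum_def sep_grad_def sum.distrib sum_distrib_left
        block_inner_sum[of "w - z"] block_inner_sum[of "w - u"])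
  finally show ?thesis .
qed

lemma convex_on_sep_sum:
  fixes f :: "'n::finite \<Rightarrow> real^'d::finite \<Rightarrow> real"
  assumes "\<And>i. convex_on UNIV (f i)"
  shows "convex_on UNIV (sep_sum f)"
proof (rule convex_onI)
  fix t :: real and a b :: "real^('n \<times> 'd)"
  assume t: "0 < t" "t < 1"
  have "sep_sum f ((1 - t) *\<^sub>R a + t *\<^sub>R b)
      \<le> (\<Sum>i\<in>UNIV. (1 - t) * f i (block i a) + t * f i (block i b))"
    unfolding sep_sum_def block_simps
    by (rule sum_mono) (use convex_onD[OF assms] t in auto)
  then show "sep_sum f ((1 - t) *\<^sub>R a + t *\<^sub>R b) \<le> (1 - t) * sep_sum f a + t * sep_sum f b"
    by (simp add: sep_sum_def sum.distrib sum_distrib_left)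
qed simp

text \<open>The convexity defect of the square is exactly \<open>t * (1 - t)\<close> times the
  square of \<open>T a - T b\<close>. This serves the penalty term, with \<open>T\<close> the matrix
  root.\<close>

lemma convex_on_inner_self_linear:
  fixes T :: "'a::real_vector \<Rightarrow> 'b::real_inner"
  assumes "linear T" "c \<ge> 0"
  shows "convex_on UNIV (\<lambda>x. c * (T x \<bullet> T x))"
proof (rule convex_onI)
  fix t :: real and a b :: 'a
  assume t: "0 < t" "t < 1"
  have "(1 - t) * (T a \<bullet> T a) + t * (T b \<bullet> T b)
      - T ((1 - t) *\<^sub>R a + t *\<^sub>R b) \<bullet> T ((1 - t) *\<^sub>R a + t *\<^sub>R b)
      = t * (1 - t) * ((T a - T b) \<bullet> (T a - T b))"
    unfolding linear_add[OF assms(1)] linear_cmul[OF assms(1)]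
    by (simp add: inner_add_left inner_add_right inner_diff_left
        inner_diff_right inner_commute algebra_simps)
  also have "\<dots> \<ge> 0" using t by simp
  finally have "T ((1 - t) *\<^sub>R a + t *\<^sub>R b) \<bullet> T ((1 - t) *\<^sub>R a + t *\<^sub>R b)
      \<le> (1 - t) * (T a \<bullet> T a) + t * (T b \<bullet> T b)" by simp
  from mult_left_mono[OF this assms(2)]
  show "c * (T ((1 - t) *\<^sub>R a + t *\<^sub>R b) \<bullet> T ((1 - t) *\<^sub>R a + t *\<^sub>R b))
      \<le> (1 - t) * (c * (T a \<bullet> T a)) + t * (c * (T b \<bullet> T b))"
    by (simp add: algebra_simps)
qed simp

section \<open>Extended-valued convex functions and the proximal inequality\<close>

lemma sum_ereal_neq_minf:
  fixes h :: "'a \<Rightarrow> ereal"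
  assumes "\<And>i. i \<in> I \<Longrightarrow> h i \<noteq> -\<infinity>"
  shows "sum h I \<noteq> -\<infinity>"
  using assms by (induction I rule: infinite_finite_induct) auto

lemma proper_fun_sep_sum:
  fixes g :: "'n::finite \<Rightarrow> real^'d::finite \<Rightarrow> ereal"
  assumes "\<And>i. proper_fun (g i)"
  shows "proper_fun (sep_sum g)"
proof -
  have "sep_sum g x \<noteq> -\<infinity>" for x
    unfolding sep_sum_def
    by (rule sum_ereal_neq_minf) (use assms in \<open>auto simp: proper_fun_def\<close>)
  moreover obtain v where "\<And>i. g i (v i) \<noteq> \<infinity>"
    using assms unfolding proper_fun_def by metis
  then have "sep_sum g (stack v) \<noteq> \<infinity>"
    by (simp add: sep_sum_def sum_Pinfty)
  ultimately show ?thesis unfolding proper_fun_def by blast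
qed

lemma convex_funD:
  assumes "convex_fun h" "h u \<le> ereal a" "h v \<le> ereal b" "0 \<le> s" "0 \<le> t" "s + t = 1"
  shows "h (s *\<^sub>R u + t *\<^sub>R v) \<le> ereal (s * a + t * b)"
  using convexD[of "epi h" "(u, a)" "(v, b)" s t] assms by (simp add: convex_fun_def epi_def)

lemma convex_fun_sep_sum:
  fixes g :: "'n::finite \<Rightarrow> real^'d::finite \<Rightarrow> ereal"
  assumes proper: "\<And>i. proper_fun (g i)" and conv: "\<And>i. convex_fun (g i)"
  shows "convex_fun (sep_sum g)"
proof -
  \<comment> \<open>A sum that is bounded above and has no summand \<open>-\<infinity>\<close> has
    only finite summands, so the convexity inequality can be checked over the reals.\<close>
  have fin: "\<exists>a. \<forall>i. g i (block i z) = ereal (a i)" if z: "sep_sum g z \<le> ereal r" for z r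
  proof -
    have "sep_sum g z \<noteq> \<infinity>" using z by auto
    then have "\<bar>g i (block i z)\<bar> \<noteq> \<infinity>" for i
      using proper by (auto simp: sep_sum_def sum_Pinfty proper_fun_def)
    then show ?thesis
      by (intro exI[of _ "\<lambda>i. real_of_ereal (g i (block i z))"]) (simp add: ereal_real')
  qed
  have "sep_sum g (s *\<^sub>R z + t *\<^sub>R w) \<le> ereal (s * r + t * q)"
    if z: "sep_sum g z \<le> ereal r" and w: "sep_sum g w \<le> ereal q" and st: "0 \<le> s" "0 \<le> t" "s + t = 1"
    for z w r q s t
  proof -
    obtain a b where a: "\<And>i. g i (block i z) = ereal (a i)" and b: "\<And>i. g i (block i w) = ereal (b i)"
      using fin[OF z] fin[OF w] by blast
    have "sep_sum g (s *\<^sub>R z + t *\<^sub>R w) \<le> (\<Sum>i\<in>UNIV. ereal (s * a i + t * b i))"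
      unfolding sep_sum_def block_simps
      by (intro sum_mono convex_funD[OF conv]) (use a b st in auto)
    also have "\<dots> = ereal (s * sum a UNIV + t * sum b UNIV)"
      by (simp add: sum.distrib sum_distrib_left)
    also have "\<dots> \<le> ereal (s * r + t * q)"
      using z w a b st by (simp add: sep_sum_def add_mono mult_left_mono)
    finally show ?thesis .
  qed
  then show ?thesis
    unfolding convex_fun_def epi_def by (intro convexI) auto
qed

text \<open>Jensen's inequality is the convex combination of the points \<open>(u i, r i)\<close> of
  the epigraph.\<close>

lemma convex_fun_sum:
  assumes "convex_fun h" "finite I" "sum a I = 1" "\<And>i. i \<in> I \<Longrightarrow> 0 \<le> a i"
    and "\<And>i. i \<in> I \<Longrightarrow> h (u i) \<le> ereal (r i)"
  shows "h (\<Sum>i\<in>I. a i *\<^sub>R u i) \<le> ereal (\<Sum>i\<in>I. a i * r i)"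
proof -
  have "(\<Sum>i\<in>I. a i *\<^sub>R (u i, r i)) \<in> epi h"
    using assms by (intro convex_sum) (auto simp: convex_fun_def epi_def)
  moreover have "(\<Sum>i\<in>I. a i *\<^sub>R (u i, r i)) = (\<Sum>i\<in>I. a i *\<^sub>R u i, \<Sum>i\<in>I. a i * r i)"
    by (simp add: prod_eq_iff fst_sum snd_sum)
  ultimately show ?thesis by (simp add: epi_def)
qed

text \<open>Compare the minimizer \<open>p\<close> with \<open>p + t(z - p)\<close> and let \<open>t \<rightarrow> 0\<close>.\<close>

lemma prox_inequality:
  fixes h :: "'a::real_inner \<Rightarrow> ereal"
  assumes conv: "convex_fun h" and \<alpha>: "\<alpha> > 0"
    and min: "\<And>z. h p + ereal (1 / (2 * \<alpha>) * (norm (p - q))\<^sup>2)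
      \<le> h z + ereal (1 / (2 * \<alpha>) * (norm (z - q))\<^sup>2)"
    and p: "h p = ereal a" and z: "h z = ereal b"
  shows "a \<le> b + (1 / \<alpha>) * ((q - p) \<bullet> (p - z))"
proof -
  \<comment> \<open>The quadratic penalty changes by \<open>t * (d + t * c)\<close> from
    \<open>p\<close> to \<open>p + t(z - p)\<close>: \<open>d\<close> is the first-order rate and
    \<open>c\<close> the second-order coefficient that disappears in the limit.\<close>
  define c where "c = (1 / (2 * \<alpha>)) * ((z - p) \<bullet> (z - p))"
  define d where "d = (1 / \<alpha>) * ((q - p) \<bullet> (p - z))"
  have key: "a \<le> b + d + t * c" if t: "0 < t" "t < 1" for t
  proof -
    define w where "w = (1 - t) *\<^sub>R p + t *\<^sub>R z"
    have hw: "h w \<le> ereal ((1 - t) * a + t * b)"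
      unfolding w_def by (rule convex_funD[OF conv]) (use p z t in auto)
    have "ereal a + ereal (1 / (2 * \<alpha>) * (norm (p - q))\<^sup>2)
        \<le> h w + ereal (1 / (2 * \<alpha>) * (norm (w - q))\<^sup>2)"
      using min[of w] by (simp only: p)
    also have "\<dots> \<le> ereal ((1 - t) * a + t * b) + ereal (1 / (2 * \<alpha>) * (norm (w - q))\<^sup>2)"
      by (rule add_right_mono[OF hw])
    finally have "a + 1 / (2 * \<alpha>) * (norm (p - q))\<^sup>2
        \<le> (1 - t) * a + t * b + 1 / (2 * \<alpha>) * (norm (w - q))\<^sup>2"
      by (simp only: plus_ereal.simps ereal_less_eq)
    then have "t * (a - b) \<le> 1 / (2 * \<alpha>) * ((norm (w - q))\<^sup>2 - (norm (p - q))\<^sup>2)"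
      by (simp add: left_diff_distrib right_diff_distrib)
    also have "(norm (w - q))\<^sup>2 - (norm (p - q))\<^sup>2
        = t * (2 * ((q - p) \<bullet> (p - z)) + t * ((z - p) \<bullet> (z - p)))"
    proof -
      have w: "w - q = (p - q) + t *\<^sub>R (z - p)" by (simp add: w_def algebra_simps)
      show ?thesis unfolding w power2_norm_eq_inner
        by (simp add: inner_add_left inner_add_right inner_diff_left inner_diff_right
            inner_commute algebra_simps)
    qed
    also have "1 / (2 * \<alpha>) * \<dots> = t * (d + t * c)"
      using \<alpha> by (simp add: c_def d_def field_simps)
    finally show ?thesis using t by simp
  qed
  have "((\<lambda>t. b + d + t * c) \<longlongrightarrow> b + d + 0 * c) (at_right 0)"
    by (intro tendsto_intros)
  moreover have "eventually (\<lambda>t. a \<le> b + d + t * c) (at_right (0::real))"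
    unfolding eventually_at_right_field by (intro exI[of _ 1]) (use key in auto)
  ultimately have "a \<le> b + d + 0 * c"
    by (intro tendsto_lowerbound[of _ _ "at_right 0"]) auto
  then show ?thesis by (simp add: d_def)
qed

subsection \<open>The primal-dual iteration\<close>

text \<open>Polarizing \<open>(u - u') \<bullet> u'\<close> and inserting the dual update, the right
  side exceeds the left by half of \<open>(1/\<alpha> - l)|v|\<^sup>2 - (\<beta> + \<rho>)|K
  v|\<^sup>2 + \<beta>|K u'|\<^sup>2\<close> with \<open>v = u' - u\<close>. The extrapolation
  \<open>2 u' - u\<close> is what reduces the terms linear in \<open>e\<close> to
  \<open>- e \<bullet> K u'\<close>.\<close>

lemma primal_dual_metric_step:
  fixes K :: "'a::real_inner \<Rightarrow> 'b::real_inner"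
  defines "P \<equiv> \<lambda>\<alpha> \<beta> u e. (u \<bullet> u) / \<alpha> - 2 * (e \<bullet> K u) + (e \<bullet> e) / \<beta>"
  assumes K: "linear K" and \<beta>: "\<beta> > 0"
    and bound: "\<And>v. (\<beta> + \<rho>) * (K v \<bullet> K v) \<le> (1 / \<alpha> - l) * (v \<bullet> v)"
    and e': "e' = e + \<beta> *\<^sub>R K (2 *\<^sub>R u' - u)"
  shows "(1 / \<alpha>) * ((u - u') \<bullet> u') - e \<bullet> K u' + l / 2 * ((u' - u) \<bullet> (u' - u))
      + \<rho> / 2 * (K (u' - u) \<bullet> K (u' - u)) \<le> 1 / 2 * (P \<alpha> \<beta> u e - P \<alpha> \<beta> u' e')"
proof -
  define s c where "s = 1 / \<alpha>" and "c = 2 *\<^sub>R K u' - K u"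
  have e'c: "e' = e + \<beta> *\<^sub>R c"
    by (simp add: e' c_def linear_diff[OF K] linear_cmul[OF K])
  have sq: "(e' \<bullet> e') / \<beta> = (e \<bullet> e) / \<beta> + 2 * (e \<bullet> c) + \<beta> * (c \<bullet> c)"
    using \<beta> by (simp add: e'c inner_add_left inner_add_right inner_commute field_simps)
  have P: "P \<alpha> \<beta> u e - P \<alpha> \<beta> u' e' =
      s * (u \<bullet> u) - s * (u' \<bullet> u') - 2 * (e \<bullet> K u) + 2 * (e \<bullet> K u') + 2 * \<beta> * (c \<bullet> K u')
        - 2 * (e \<bullet> c) - \<beta> * (c \<bullet> c)"
    unfolding P_def sq by (simp add: s_def e'c inner_add_left)
  \<comment> \<open>The vector squared here is \<open>- K u'\<close>; its square is the surplus
    term.\<close>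
  have "0 \<le> \<beta> * ((K (u' - u) - c) \<bullet> (K (u' - u) - c))" using \<beta> by simp
  moreover note bound[of "u' - u"]
  ultimately show ?thesis
    unfolding P s_def[symmetric] c_def linear_diff[OF K]
    by (simp add: inner_diff_left inner_diff_right inner_commute algebra_simps)
qed

text \<open>Complete the square in \<open>e\<close>; the hypothesis bounds what remains in
  \<open>u\<close>.\<close>

lemma primal_dual_metric_nonneg:
  fixes K :: "'a::real_inner \<Rightarrow> 'b::real_inner"
  assumes "\<beta> > 0" and "\<beta> * (K u \<bullet> K u) \<le> 1 / \<alpha> * (u \<bullet> u)"
  shows "0 \<le> (u \<bullet> u) / \<alpha> - 2 * (e \<bullet> K u) + (e \<bullet> e) / \<beta>"
proof -
  have "0 \<le> ((e - \<beta> *\<^sub>R K u) \<bullet> (e - \<beta> *\<^sub>R K u)) / \<beta>" using assms(1) by simp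
  also have "\<dots> = \<beta> * (K u \<bullet> K u) - 2 * (e \<bullet> K u) + (e \<bullet> e) / \<beta>"
    using assms(1) by (simp add: inner_diff_left inner_diff_right inner_commute field_simps)
  finally show ?thesis using assms(2) by simp
qed

theorem theorem1:
  fixes E :: "('n::finite \<times> 'n) set"
    and f :: "'n \<Rightarrow> real^'d::finite \<Rightarrow> real"
    and g :: "'n \<Rightarrow> real^'d \<Rightarrow> ereal"
    and Lc :: "'n \<Rightarrow> real"
    and L :: "real^'n^'n"
    and M S :: "real^('n \<times> 'd)^('n \<times> 'd)"
    and \<rho> \<alpha> \<beta> lam_max Lf :: real
    and xs ys :: "real^('n \<times> 'd)"
    and x xh y :: "nat \<Rightarrow> real^('n \<times> 'd)"
    and N :: nat
  defines "L \<equiv> laplacian E"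
    and "M \<equiv> L \<otimes>\<^sub>K mat 1"
    and "S \<equiv> psd_sqrt M"
    and "lam_max \<equiv> largest_eigenvalue L"
    and "Lf \<equiv> Max (range Lc)"
  assumes "simple_graph E" and "connected_graph E"
    and "\<And>i. closed_fun (\<lambda>u. ereal (f i u))"
    and "\<And>i. proper_fun (\<lambda>u. ereal (f i u))"
    and "\<And>i. convex_on UNIV (f i)"
    and "\<And>i. f i differentiable_on UNIV"
    and "\<And>i. (Lc i)-lipschitz_on UNIV (grad (f i))"
    and "\<And>i. proper_fun (g i)" and "\<And>i. convex_fun (g i)"
    and "\<And>i. lower_semicontinuous (g i)"
    and "\<rho> \<ge> 0"
    and "saddle_point_on UNIV ((mat_kernel S)\<^sup>\<bottom>) (lagrangian M f g \<rho>) xs ys"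
    and "\<alpha> > 0" and "\<beta> > 0"
    and "1 / (\<beta> + \<rho>) * (1 / \<alpha> - Lf) \<ge> lam_max"
    and "x 0 \<in> mat_kernel S" and "y 0 \<in> (mat_kernel S)\<^sup>\<bottom>"
    and "\<And>k. xh (Suc k) = x k - \<alpha> *\<^sub>R (sep_grad f (x k) + S *v y k + \<rho> *\<^sub>R (M *v x k))"
    and "\<And>k. is_arg_min
               (\<lambda>z. sep_sum g z + ereal (1 / (2 * \<alpha>) * (norm (z - xh (Suc k)))\<^sup>2))
               (\<lambda>z. True) (x (Suc k))"
    and "\<And>k. y (Suc k) = y k + \<beta> *\<^sub>R (S *v (2 *\<^sub>R x (Suc k) - x k))"
    and "N \<ge> 1"
  shows "lagrangian M f g \<rho> ((1 / real N) *\<^sub>R (\<Sum>k=1..N. x k)) ys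
           - lagrangian M f g \<rho> xs ((1 / real N) *\<^sub>R (\<Sum>k=1..N. y k))
         \<le> ereal (1 / real N * ((norm (xs - x 0))\<^sup>2 / (2 * \<alpha>) + (norm (ys - y 0))\<^sup>2 / (2 * \<beta>)))"
proof -
  note diff = assms(11) and lip = assms(12) and gprop = assms(13) and gconv = assms(14)
    and rho = assms(16) and saddle = assms(17) and alpha = assms(18) and beta = assms(19)
    and cond = assms(20) and x0 = assms(21) and y0 = assms(22) and xh = assms(23)
    and xmin = assms(24) and ystep = assms(25) and N = assms(26)
  have psdL: "pos_semidef L"
    using assms(6) by (simp add: L_def simple_graph_def pos_semidef_laplacian)
  have psdM: "pos_semidef M"
    unfolding M_def by (rule pos_semidef_kronecker_identity[OF psdL])
  have symS: "u \<bullet> (S *v v) = (S *v u) \<bullet> v" for u v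
    using psd_sqrt_properties(1)[OF psdM] symmetric_matrix_iff_selfadjoint[of S]
    by (simp add: S_def pos_semidef_def)
  have MS: "M *v v = S *v (S *v v)" for v
    using psd_sqrt_properties(2)[OF psdM] by (simp add: S_def matrix_vector_mul_assoc)
  have MSS: "v \<bullet> (M *v v) = (S *v v) \<bullet> (S *v v)" for v
    by (simp add: MS symS)
  note linS = matrix_vector_mul_linear[of S]

  have Lf: "0 \<le> Lf"
  proof -
    have "0 \<le> Lc undefined" by (rule lipschitz_on_nonneg[OF lip])
    also have "\<dots> \<le> Lf" unfolding Lf_def by (rule Max_ge) auto
    finally show ?thesis .
  qed
  have cond': "(\<beta> + \<rho>) * lam_max \<le> 1 / \<alpha> - Lf"
    using cond beta rho by (simp add: field_simps)
  have bound: "(\<beta> + \<rho>) * ((S *v v) \<bullet> (S *v v)) \<le> (1 / \<alpha> - Lf) * (v \<bullet> v)" for v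
  proof -
    have "(S *v v) \<bullet> (S *v v) \<le> lam_max * (v \<bullet> v)"
      using kronecker_identity_quadratic_form_le[of L v] psdL
      by (simp add: MSS[symmetric] M_def lam_max_def pos_semidef_def)
    then have "(\<beta> + \<rho>) * ((S *v v) \<bullet> (S *v v)) \<le> (\<beta> + \<rho>) * (lam_max * (v \<bullet> v))"
      using beta rho by (intro mult_left_mono) auto
    also have "\<dots> \<le> (1 / \<alpha> - Lf) * (v \<bullet> v)"
      using mult_right_mono[OF cond', of "v \<bullet> v"] by (simp add: mult.assoc)
    finally show ?thesis .
  qed
  \<comment> \<open>Dropping the nonnegative \<open>\<rho>\<close> and \<open>Lf\<close> terms
    leaves the condition under which \<open>P\<close> is nonnegative.\<close>
  have bound0: "\<beta> * ((S *v v) \<bullet> (S *v v)) \<le> 1 / \<alpha> * (v \<bullet> v)" for v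
  proof -
    have "0 \<le> \<rho> * ((S *v v) \<bullet> (S *v v))" "0 \<le> Lf * (v \<bullet> v)" using rho Lf by auto
    then show ?thesis using bound[of v] by (simp add: distrib_right left_diff_distrib)
  qed

  define G where "G = sep_sum g"
  have Gprop: "proper_fun G" and Gconv: "convex_fun G"
    unfolding G_def using proper_fun_sep_sum convex_fun_sep_sum gprop gconv by blast+
  \<comment> \<open>All finite-valued parts that are free of the dual variable go into
    \<open>F\<close>, so that \<open>G\<close> is the only term that can be infinite.\<close>
  define F where "F z = sep_sum f z + \<rho> / 2 * ((S *v z) \<bullet> (S *v z))" for z
  have Lagr: "lagrangian M f g \<rho> z w = G z + ereal (F z + w \<bullet> (S *v z))" for z w
    by (cases "G z") (simp_all add: lagrangian_def G_def F_def MSS S_def[symmetric])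
  obtain z0 c0 where z0: "G z0 = ereal c0"
    using Gprop unfolding proper_fun_def by (metis ereal_cases)
  \<comment> \<open>Comparison with a point of finite value forces finiteness; this applies both to
    the saddle point and to the proximal minimizers.\<close>
  have Gfin: "\<exists>c. G z = ereal c" if "G z + ereal r \<le> G z0 + ereal r'" for z r r'
    using that z0 Gprop by (cases "G z") (auto simp: proper_fun_def)

  have ysmem: "ys \<in> (mat_kernel S)\<^sup>\<bottom>"
    and sad1: "\<And>w. w \<in> (mat_kernel S)\<^sup>\<bottom> \<Longrightarrow> lagrangian M f g \<rho> xs w \<le> lagrangian M f g \<rho> xs ys"
    and sad2: "\<And>z. lagrangian M f g \<rho> xs ys \<le> lagrangian M f g \<rho> z ys"
    using saddle unfolding saddle_point_on_def by blast+
  obtain b where b: "G xs = ereal b"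
    using Gfin sad2[of z0] unfolding Lagr by blast
  have Sxs: "S *v xs = 0"
  proof -
    \<comment> \<open>Test the dual side of the saddle point with \<open>ys + S *v xs\<close>,
      admissible because the range of the symmetric \<open>S\<close> is orthogonal to its kernel.
      The Lagrangian grows by the square of \<open>S *v xs\<close>, which must therefore be
      zero.\<close>
    have "S *v xs \<in> (mat_kernel S)\<^sup>\<bottom>"
      by (simp add: orthogonal_comp_def mat_kernel_def orthogonal_def symS)
    then have "ys + S *v xs \<in> (mat_kernel S)\<^sup>\<bottom>"
      using ysmem subspace_orthogonal_comp by (metis subspace_add)
    from sad1[OF this] have "(S *v xs) \<bullet> (S *v xs) \<le> 0"
      by (simp add: Lagr b inner_add_left)
    then show ?thesis by (metis inner_eq_zero_iff inner_ge_zero order_antisym)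
  qed

  have xmin': "G (x (Suc k)) + ereal (1 / (2 * \<alpha>) * (norm (x (Suc k) - xh (Suc k)))\<^sup>2)
      \<le> G z + ereal (1 / (2 * \<alpha>) * (norm (z - xh (Suc k)))\<^sup>2)" for k z
    using xmin[of k] unfolding is_arg_min_linorder G_def by blast
  have "\<forall>k. \<exists>c. G (x (Suc k)) = ereal c"
    using xmin' Gfin by blast
  \<comment> \<open>The index is shifted: \<open>a k\<close> is the value of \<open>G\<close> at
    \<open>x (Suc k)\<close>. Finiteness comes from the proximal step, so \<open>x 0\<close> is
    excluded.\<close>
  then obtain a where a: "\<And>k. G (x (Suc k)) = ereal (a k)" by metis

  define P where "P u e = (u \<bullet> u) / \<alpha> - 2 * (e \<bullet> (S *v u)) + (e \<bullet> e) / \<beta>" for u e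
  have step: "F (x (Suc k)) + a k + ys \<bullet> (S *v x (Suc k)) - (F xs + b)
      \<le> 1 / 2 * (P (x k - xs) (y k - ys) - P (x (Suc k) - xs) (y (Suc k) - ys))" for k
  proof -
    define u u' where "u = x k - xs" and "u' = x (Suc k) - xs"
    define D where "D = x (Suc k) - x k"
    have D: "D = u' - u" by (simp add: D_def u_def u'_def)
    have Su: "S *v x k = S *v u" "S *v x (Suc k) = S *v u'"
      by (simp_all add: u_def u'_def matrix_vector_mult_diff_distrib Sxs)
    let ?d = "sep_grad f (x k)"
    have xhx: "xh (Suc k) - x (Suc k) = (u - u') - \<alpha> *\<^sub>R (?d + S *v y k + \<rho> *\<^sub>R (S *v (S *v u)))"
      by (simp add: xh MS Su(1)) (simp add: u_def u'_def)
    have "a k \<le> b + (1 / \<alpha>) * ((xh (Suc k) - x (Suc k)) \<bullet> u')"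
      unfolding u'_def by (rule prox_inequality[OF Gconv alpha xmin' a b])
    also have "(xh (Suc k) - x (Suc k)) \<bullet> u'
        = (u - u') \<bullet> u' - \<alpha> * (?d \<bullet> u' + y k \<bullet> (S *v u') + \<rho> * ((S *v u) \<bullet> (S *v u')))"
      unfolding xhx by (simp add: symS inner_diff_left inner_add_left)
    finally have 1: "a k \<le> b + (1 / \<alpha>) * ((u - u') \<bullet> u')
        - (?d \<bullet> u' + y k \<bullet> (S *v u') + \<rho> * ((S *v u) \<bullet> (S *v u')))"
      using alpha by (simp add: right_diff_distrib)
    have 2: "sep_sum f (x (Suc k)) \<le> sep_sum f xs + ?d \<bullet> u' + Lf / 2 * (D \<bullet> D)"
      using sep_sum_three_point[where f = f and Lc = Lc and w = "x (Suc k)" and z = xs and u = "x k",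
        OF assms(10) diff lip]
      by (simp add: Lf_def D_def u'_def inner_commute)
    \<comment> \<open>The two sides differ by the square of \<open>S *v u\<close>. This trades the
      penalty value at the new iterate for its gradient at the old one, at the cost of an error
      quadratic in \<open>D\<close>.\<close>
    have "(S *v u') \<bullet> (S *v u') \<le> 2 * ((S *v u) \<bullet> (S *v u')) + (S *v D) \<bullet> (S *v D)"
      using inner_ge_zero[of "S *v u"]
      by (simp add: D matrix_vector_mult_diff_distrib inner_diff_left inner_diff_right inner_commute)
    from mult_left_mono[OF this, of "\<rho> / 2"] rho
    have 3: "\<rho> / 2 * ((S *v u') \<bullet> (S *v u'))
        \<le> \<rho> * ((S *v u) \<bullet> (S *v u')) + \<rho> / 2 * ((S *v D) \<bullet> (S *v D))"
      by (simp add: distrib_left)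
    have y: "y (Suc k) - ys = (y k - ys) + \<beta> *\<^sub>R (S *v (2 *\<^sub>R u' - u))"
      by (simp add: ystep matrix_vector_mult_diff_distrib matrix_vector_mult_scaleR Su)
    have "(1 / \<alpha>) * ((u - u') \<bullet> u') - (y k - ys) \<bullet> (S *v u') + Lf / 2 * (D \<bullet> D)
        + \<rho> / 2 * ((S *v D) \<bullet> (S *v D))
        \<le> 1 / 2 * (P u (y k - ys) - P u' (y (Suc k) - ys))"
      unfolding P_def D by (rule primal_dual_metric_step[OF linS beta bound y])
    note 4 = this[unfolded inner_diff_left[of "y k" ys]]
    have "F (x (Suc k)) = sep_sum f (x (Suc k)) + \<rho> / 2 * ((S *v u') \<bullet> (S *v u'))"
      and "F xs = sep_sum f xs"
      by (simp_all add: F_def Su Sxs)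
    \<comment> \<open>On adding 1 to 4 the terms \<open>?d \<bullet> u'\<close>,
      \<open>y k \<bullet> (S *v u')\<close> and
      \<open>\<rho> * ((S *v u) \<bullet> (S *v u'))\<close> cancel, and the errors in
      \<open>D\<close> are those absorbed in 4.\<close>
    then show ?thesis
      unfolding u_def[symmetric] u'_def[symmetric] Su using 1 2 3 4 by linarith
  qed

  have "(\<Sum>k<N. F (x (Suc k)) + a k + ys \<bullet> (S *v x (Suc k)) - (F xs + b))
      \<le> (\<Sum>k<N. 1 / 2 * (P (x k - xs) (y k - ys) - P (x (Suc k) - xs) (y (Suc k) - ys)))"
    by (rule sum_mono[OF step])
  also have "\<dots> = 1 / 2 * (P (x 0 - xs) (y 0 - ys) - P (x N - xs) (y N - ys))"
    unfolding sum_distrib_left[symmetric]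
    by (subst sum_lessThan_telescope'[where f = "\<lambda>k. P (x k - xs) (y k - ys)"]) simp
  also have "\<dots> \<le> 1 / 2 * P (x 0 - xs) (y 0 - ys)"
  proof -
    have "0 \<le> P (x N - xs) (y N - ys)"
      unfolding P_def by (rule primal_dual_metric_nonneg[of \<beta> "(*v) S", OF beta bound0])
    then show ?thesis by simp
  qed
  also have "\<dots> = (norm (xs - x 0))\<^sup>2 / (2 * \<alpha>) + (norm (ys - y 0))\<^sup>2 / (2 * \<beta>)"
  proof -
    have "S *v (x 0 - xs) = 0"
      using x0 Sxs by (simp add: mat_kernel_def matrix_vector_mult_diff_distrib)
    then show ?thesis
      by (simp add: P_def power2_norm_eq_inner[symmetric] norm_minus_commute)
  qed
  finally have total: "(\<Sum>k<N. F (x (Suc k)) + a k + ys \<bullet> (S *v x (Suc k)) - (F xs + b))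
      \<le> (norm (xs - x 0))\<^sup>2 / (2 * \<alpha>) + (norm (ys - y 0))\<^sup>2 / (2 * \<beta>)" .

  \<comment> \<open>The average runs over the iterates 1 to N, written as \<open>x (Suc k)\<close>
    with \<open>k < N\<close> to match the telescoped sum.\<close>
  define xb where "xb = (\<Sum>k<N. (1 / real N) *\<^sub>R x (Suc k))"
  have xb: "(1 / real N) *\<^sub>R (\<Sum>k=1..N. x k) = xb"
  proof -
    have "(\<Sum>k=1..N. x k) = (\<Sum>k<N. x (Suc k))"
      by (rule sum.reindex_bij_witness[of _ Suc "\<lambda>k. k - 1"]) auto
    then show ?thesis by (simp add: xb_def scaleR_sum_right)
  qed
  have wt: "(\<Sum>k<N. 1 / real N) = 1" using N by simp
  have ne: "{..<N} \<noteq> {}" using N by (auto simp: lessThan_empty_iff)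
  have Gxb: "G xb \<le> ereal (\<Sum>k<N. 1 / real N * a k)"
    unfolding xb_def by (rule convex_fun_sum[OF Gconv _ wt]) (auto simp: a)
  have "convex_on UNIV F"
    unfolding F_def using rho
    by (intro convex_on_add convex_on_sep_sum assms(10) convex_on_inner_self_linear linS) simp
  then have Fxb: "F xb \<le> (\<Sum>k<N. 1 / real N * F (x (Suc k)))"
    unfolding xb_def by (intro convex_on_sum ne wt) auto
  have Sxb: "ys \<bullet> (S *v xb) = (\<Sum>k<N. 1 / real N * (ys \<bullet> (S *v x (Suc k))))"
    unfolding xb_def by (simp add: linear_sum[OF linS] linear_cmul[OF linS] inner_sum_right)
  have "lagrangian M f g \<rho> xb ys \<le> ereal (\<Sum>k<N. 1 / real N * a k) + ereal (F xb + ys \<bullet> (S *v xb))"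
    unfolding Lagr by (rule add_right_mono[OF Gxb])
  \<comment> \<open>Because \<open>S *v xs = 0\<close>, the Lagrangian at \<open>xs\<close> is
    constant in the dual variable, so the averaged dual iterate contributes nothing. Its value is
    finite, which makes the extended-real subtraction harmless.\<close>
  moreover have "lagrangian M f g \<rho> xs w = ereal (b + F xs)" for w
    by (simp add: Lagr b Sxs)
  ultimately have "lagrangian M f g \<rho> xb ys - lagrangian M f g \<rho> xs ((1 / real N) *\<^sub>R (\<Sum>k=1..N. y k))
      \<le> ereal (\<Sum>k<N. 1 / real N * a k) + ereal (F xb + ys \<bullet> (S *v xb)) - ereal (b + F xs)"
    by (metis ereal_minus_mono order_refl)
  also have "\<dots> = ereal ((\<Sum>k<N. 1 / real N * a k) + (F xb + ys \<bullet> (S *v xb)) - (b + F xs))"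
    by simp
  also have "\<dots> \<le> ereal (1 / real N *
      (\<Sum>k<N. F (x (Suc k)) + a k + ys \<bullet> (S *v x (Suc k)) - (F xs + b)))"
  proof -
    have "1 / real N * (\<Sum>k<N. F (x (Suc k)) + a k + ys \<bullet> (S *v x (Suc k)) - (F xs + b))
        = (\<Sum>k<N. 1 / real N * F (x (Suc k))) + (\<Sum>k<N. 1 / real N * a k)
          + (\<Sum>k<N. 1 / real N * (ys \<bullet> (S *v x (Suc k)))) - (F xs + b)"
      using N by (simp only: sum.distrib sum_subtractf sum_distrib_left distrib_left
          right_diff_distrib) simp
    then show ?thesis using Fxb Sxb by simp
  qed
  also have "\<dots> \<le> ereal (1 / real N *
      ((norm (xs - x 0))\<^sup>2 / (2 * \<alpha>) + (norm (ys - y 0))\<^sup>2 / (2 * \<beta>)))"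
    using mult_left_mono[OF total, of "1 / real N"] by simp
  finally show ?thesis unfolding xb .
qed

end
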